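(* Let $m \geq 2$ and $k \geq 2$ be integers, and let $T$ be a perfect $m$-ary tree of depth $d$ with $k \leq d \leq \frac{3k}{2}$. Then $\gamma_{all,k}^\infty(T) = 1+m^{d-k}$.
   Context: A perfect $m$-ary tree of depth $d$ is a rooted tree in which every non-leaf vertex has exactly $m$ children and every leaf is at distance exactly $d$ from the root. Graphs are finite and simple; $d(u,v)$ is graph distance and $N_k[x]=\{v: d(x,v)\le k\}$. A multiset $D$ of vertices of $G$ is a distance-$k$ dominating set if every vertex of $V(G)\setminus D$ is at distance at most $k$ from some element of $D$. Let $\mathbb{D}_{k,q}(G)$ be the set of such multisets of cardinality $q$. $D=\{v_1,\dots,v_q\}$ transforms to $D'=\{u_1,\dots,u_q\}$ if (for some indexing) $u_i\in N_k[v_i]$ for all $i$. An eternal distance-$k$ dominating family is $\mathcal{E}\subseteq\mathbb{D}_{k,q}(G)$ for some $q$ such that for every $D\in\mathcal{E}$ and every vertex $v$ there is $D'\in\mathcal{E}$ with $v\in D'$ and $D$ transforms to $D'$. $\gamma_{all,k}^\infty(G)$ is the minimum $q$ for which such a family exists. *)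

theory Defs
  imports
    "HOL-Library.Multiset"
    "Graph_Theory.Digraph_Component"
    "Graph_Theory.Shortest_Path"
begin

text \<open>
  A finite simple graph is a digraph satisfying the locale predicate \<^const>\<open>graph\<close>: finite,
  symmetric, without loops and without parallel arcs, so that every edge is a pair of opposite arcs.
\<close>

definition gdist :: "('a, 'b) pre_digraph \<Rightarrow> 'a \<Rightarrow> 'a \<Rightarrow> ereal" where
  "gdist G u v = wf_digraph.\<mu> G (\<lambda>_. 1) u v"

definition nbhd :: "('a, 'b) pre_digraph \<Rightarrow> nat \<Rightarrow> 'a \<Rightarrow> 'a set" where
  "nbhd G k x = {v \<in> verts G. gdist G x v \<le> ereal (real k)}"

text \<open>
  \<^const>\<open>tree\<close> is unsuitable for symmetric digraphs: there an edge traversed back and forth is a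
  cycle of length 2 in the sense of \<^const>\<open>pre_digraph.cycle\<close>, so only edgeless graphs would be
  forests. The cycles of an undirected simple graph are those of length at least 3.
\<close>

definition undirected_tree :: "('a, 'b) pre_digraph \<Rightarrow> bool" where
  "undirected_tree G \<longleftrightarrow>
     graph G \<and> connected G \<and> \<not> (\<exists>p. pre_digraph.cycle G p \<and> length p \<ge> 3)"

definition children :: "('a, 'b) pre_digraph \<Rightarrow> 'a \<Rightarrow> 'a \<Rightarrow> 'a set" where
  "children G r v = {w \<in> verts G. v \<rightarrow>\<^bsub>G\<^esub> w \<and> gdist G r w = gdist G r v + 1}"

text \<open>
  A leaf of a rooted tree is a vertex without children.
\<close>

definition perfect_tree :: "nat \<Rightarrow> nat \<Rightarrow> ('a, 'b) pre_digraph \<Rightarrow> 'a \<Rightarrow> bool" where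
  "perfect_tree m d G r \<longleftrightarrow>
     undirected_tree G \<and> r \<in> verts G \<and>
     (\<forall>v \<in> verts G. children G r v \<noteq> {} \<longrightarrow> card (children G r v) = m) \<and>
     (\<forall>v \<in> verts G. children G r v = {} \<longrightarrow> gdist G r v = ereal (real d))"

definition distance_dominating :: "('a, 'b) pre_digraph \<Rightarrow> nat \<Rightarrow> 'a multiset \<Rightarrow> bool" where
  "distance_dominating G k D \<longleftrightarrow>
     set_mset D \<subseteq> verts G \<and>
     (\<forall>v \<in> verts G - set_mset D. \<exists>u \<in># D. gdist G v u \<le> ereal (real k))"

definition dominating_msets :: "('a, 'b) pre_digraph \<Rightarrow> nat \<Rightarrow> nat \<Rightarrow> 'a multiset set" where
  "dominating_msets G k q = {D. distance_dominating G k D \<and> size D = q}"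

definition transforms_to ::
    "('a, 'b) pre_digraph \<Rightarrow> nat \<Rightarrow> 'a multiset \<Rightarrow> 'a multiset \<Rightarrow> bool" where
  "transforms_to G k D D' \<longleftrightarrow> rel_mset (\<lambda>v u. u \<in> nbhd G k v) D D'"

text \<open>
  Non-emptiness is required explicitly, since the empty family would satisfy the remaining
  conditions for every \<open>q\<close>, making the minimum \<open>0\<close> for every graph.
\<close>

definition eternal_dominating_family ::
    "('a, 'b) pre_digraph \<Rightarrow> nat \<Rightarrow> nat \<Rightarrow> 'a multiset set \<Rightarrow> bool" where
  "eternal_dominating_family G k q \<E> \<longleftrightarrow>
     \<E> \<noteq> {} \<and> \<E> \<subseteq> dominating_msets G k q \<and>
     (\<forall>D \<in> \<E>. \<forall>v \<in> verts G. \<exists>D' \<in> \<E>. v \<in># D' \<and> transforms_to G k D D')"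

definition eternal_domination_number :: "('a, 'b) pre_digraph \<Rightarrow> nat \<Rightarrow> nat" where
  "eternal_domination_number G k = (LEAST q. \<exists>\<E>. eternal_dominating_family G k q \<E>)"

end

theory Submission
  imports Defs
begin

text \<open>Put \<open>j = d - k\<close>; the hypothesis on \<open>d\<close> says exactly that
  \<open>2 * j <= k\<close>.

  Lower bound: a walk of length at most \<open>k\<close> that starts in a leaf cannot climb above
  level \<open>j\<close>, so a leaf is dominated only from within the subtree, rooted on level
  \<open>j\<close>, that contains it (\<open>ancestor_short_walk\<close>,
  \<open>dominating_depth\<close>). Hence each of the \<open>m ^ j\<close> subtrees holds a guard.
  After an attack on a leaf \<open>x0\<close> some guard stands on \<open>x0\<close>. Leaves below
  another child of the same subtree root are at distance \<open>2 * k > k\<close> from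
  \<open>x0\<close>, so that subtree holds a second guard (\<open>eternal_lower_bound\<close>).

  Upper bound: one guard on every vertex of level \<open>j\<close> and one free guard anywhere.
  Level \<open>j\<close> is within distance \<open>k\<close> of every vertex
  (\<open>level_near\<close>), and two of its vertices are within \<open>2 * j <= k\<close> of each
  other (\<open>level_dist\<close>), so the free position can be moved anywhere by at most three
  guard moves (\<open>eternal_family_exists\<close>).

  The tree structure used here, unique parents and hence ancestors, comes from the absence of
  cycles: two candidate parents are joined by a path that goes no deeper than they do, and their
  common child would close it.\<close>

section \<open>Hop distance\<close>

context wf_digraph
begin

lemma awalk_cost_one: "awalk_cost (\<lambda>_. 1) p = real (length p)"
  by (induction p) auto

lemma awalk_imp_relpow: "awalk u p v \<Longrightarrow> (u, v) \<in> arcs_ends G ^^ length p"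
proof (induction p arbitrary: u)
  case Nil
  then show ?case by (simp add: awalk_Nil_iff)
next
  case (Cons e p)
  then have "(u, head G e) \<in> arcs_ends G" "awalk (head G e) p v"
    by (auto simp: awalk_Cons_iff in_arcs_imp_in_arcs_ends)
  with Cons.IH show ?case
    by (metis length_Cons relpow_Suc_I2)
qed

lemma relpow_imp_awalk:
  assumes "(u, v) \<in> arcs_ends G ^^ n" "u \<in> verts G"
  shows "\<exists>p. awalk u p v \<and> length p = n"
  using assms
proof (induction n arbitrary: u)
  case 0
  then show ?case by (auto simp: awalk_Nil_iff)
next
  case (Suc n)
  from Suc.prems(1) obtain w where w: "(u, w) \<in> arcs_ends G" "(w, v) \<in> arcs_ends G ^^ n"
    by (meson relpow_Suc_D2)
  then obtain p where "awalk w p v" "length p = n"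
    using Suc.IH adj_in_verts by blast
  moreover obtain e where "e \<in> arcs G" "tail G e = u" "head G e = w"
    using w(1) by auto
  ultimately have "awalk u (e # p) v \<and> length (e # p) = Suc n"
    by (auto simp: awalk_Cons_iff)
  then show ?case by blast
qed

lemma gdist_le_of_relpow:
  assumes "(u, v) \<in> arcs_ends G ^^ n" "u \<in> verts G"
  shows "gdist G u v \<le> ereal (real n)"
proof -
  obtain p where "awalk u p v" "length p = n"
    using relpow_imp_awalk[OF assms] by blast
  then show ?thesis
    unfolding gdist_def using min_cost_le_walk_cost[of u p v "\<lambda>_. 1"] by (simp add: awalk_cost_one)
qed

end

text \<open>With nonnegative arc costs the infimum defining \<open>gdist\<close> is attained by a
  path, which gives a natural number.\<close>

lemma (in fin_digraph) gdist_attained: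
  assumes "u \<rightarrow>\<^sup>* v"
  shows "\<exists>n. (u, v) \<in> arcs_ends G ^^ n \<and> gdist G u v = ereal (real n)"
proof -
  obtain p where "apath u p v" "gdist G u v = awalk_cost (\<lambda>_. 1) p"
    unfolding gdist_def using min_cost_awalk[OF assms, of "\<lambda>_. 1"] by auto
  then show ?thesis
    using awalk_imp_relpow awalkI_apath by (auto simp: awalk_cost_one)
qed

section \<open>Levels of a rooted graph\<close>

locale rooted_graph = graph G for G :: "('a, 'b) pre_digraph" (structure) +
  fixes r :: 'a
  assumes root_in_verts: "r \<in> verts G"
    and root_reaches: "v \<in> verts G \<Longrightarrow> r \<rightarrow>\<^sup>* v"
begin

text \<open>A natural-number version of the distance from the root, tied to \<open>gdist\<close> by
  \<open>gdist_root\<close>; it keeps extended reals out of the level arguments.\<close>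

definition depth :: "'a \<Rightarrow> nat" where
  "depth v = (LEAST n. (r, v) \<in> arcs_ends G ^^ n)"

lemma relpow_sym: "(u, v) \<in> arcs_ends G ^^ n \<Longrightarrow> (v, u) \<in> arcs_ends G ^^ n"
proof (induction n arbitrary: u)
  case 0
  then show ?case by simp
next
  case (Suc n)
  then obtain w where "(u, w) \<in> arcs_ends G" "(w, v) \<in> arcs_ends G ^^ n"
    by (meson relpow_Suc_D2)
  with Suc.IH show ?case
    by (meson graph_symmetric relpow_Suc_I)
qed

text \<open>The bridge from distance to walk lengths: connectedness through the root makes every
  distance finite and attained.\<close>

lemma gdist_le_iff:
  assumes "u \<in> verts G" "v \<in> verts G"
  shows "gdist G u v \<le> ereal (real n) \<longleftrightarrow> (\<exists>i\<le>n. (u, v) \<in> arcs_ends G ^^ i)"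
proof
  have "u \<rightarrow>\<^sup>* v"
    using assms root_reaches symmetric_reachable' reachable_trans by blast
  moreover assume "gdist G u v \<le> ereal (real n)"
  ultimately show "\<exists>i\<le>n. (u, v) \<in> arcs_ends G ^^ i"
    using gdist_attained[of u v] by auto
next
  assume "\<exists>i\<le>n. (u, v) \<in> arcs_ends G ^^ i"
  then obtain i where "i \<le> n" "gdist G u v \<le> ereal (real i)"
    using gdist_le_of_relpow assms(1) by blast
  moreover from \<open>i \<le> n\<close> have "ereal (real i) \<le> ereal (real n)" by simp
  ultimately show "gdist G u v \<le> ereal (real n)" by (meson order_trans)
qed

lemma depth_le: "(r, v) \<in> arcs_ends G ^^ n \<Longrightarrow> depth v \<le> n"
  unfolding depth_def by (rule Least_le)

lemma root_relpow_depth: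
  assumes "v \<in> verts G"
  shows "(r, v) \<in> arcs_ends G ^^ depth v"
proof -
  obtain n where "(r, v) \<in> arcs_ends G ^^ n"
    using gdist_attained root_reaches[OF assms] by blast
  then show ?thesis unfolding depth_def by (rule LeastI)
qed

lemma gdist_root:
  assumes "v \<in> verts G"
  shows "gdist G r v = ereal (real (depth v))"
proof -
  obtain n where n: "(r, v) \<in> arcs_ends G ^^ n" "gdist G r v = ereal (real n)"
    using gdist_attained root_reaches[OF assms] by blast
  have "gdist G r v \<le> ereal (real (depth v))"
    using gdist_le_of_relpow root_relpow_depth[OF assms] root_in_verts by blast
  with n depth_le[OF n(1)] show ?thesis by simp
qed

lemma depth_eq_0_iff: "v \<in> verts G \<Longrightarrow> depth v = 0 \<longleftrightarrow> v = r"
  using root_relpow_depth[of v] depth_le[of r 0] by auto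

lemma depth_arc_le: "(u, v) \<in> arcs_ends G \<Longrightarrow> depth v \<le> Suc (depth u)"
  using root_relpow_depth[of u] adj_in_verts(1) depth_le by (meson relpow_Suc_I)

lemma depth_relpow_le: "(u, v) \<in> arcs_ends G ^^ n \<Longrightarrow> depth v \<le> depth u + n"
proof (induction n arbitrary: v)
  case 0
  then show ?case by simp
next
  case (Suc n)
  then obtain w where "(u, w) \<in> arcs_ends G ^^ n" "(w, v) \<in> arcs_ends G"
    by (meson relpow_Suc_E)
  with Suc.IH[of w] depth_arc_le[of w v] show ?case by simp
qed

lemma ex_parent:
  assumes "v \<in> verts G" "depth v = Suc n"
  shows "\<exists>u. (u, v) \<in> arcs_ends G \<and> depth u = n"
proof -
  have "(r, v) \<in> arcs_ends G ^^ Suc n"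
    using root_relpow_depth[OF assms(1)] assms(2) by simp
  then obtain u where u: "(r, u) \<in> arcs_ends G ^^ n" "(u, v) \<in> arcs_ends G"
    by (meson relpow_Suc_E)
  then have "depth u = n"
    using depth_le[OF u(1)] depth_arc_le[OF u(2)] assms(2) by simp
  with u show ?thesis by blast
qed

lemma children_conv: "v \<in> verts G \<Longrightarrow>
    children G r v = {w. (v, w) \<in> arcs_ends G \<and> depth w = Suc (depth v)}"
  unfolding children_def using adj_in_verts(2) by (auto simp: gdist_root one_ereal_def)

definition level :: "nat \<Rightarrow> 'a set" where
  "level n = {v \<in> verts G. depth v = n}"

lemma finite_level: "finite (level n)"
  by (simp add: level_def)

section \<open>Paths inside balls around the root\<close>

lemma root_connected_in_ball:
  "v \<in> verts G \<Longrightarrow> depth v \<le> n \<Longrightarrow> (r, v) \<in> (Restr (arcs_ends G) {x. depth x \<le> n})\<^sup>*"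
proof (induction "depth v" arbitrary: v)
  case 0
  then show ?case by (simp add: depth_eq_0_iff)
next
  case (Suc l)
  then obtain u where u: "(u, v) \<in> arcs_ends G" "depth u = l"
    using ex_parent by metis
  then have "(r, u) \<in> (Restr (arcs_ends G) {x. depth x \<le> n})\<^sup>*"
    using Suc adj_in_verts(1)[OF u(1)] by auto
  moreover have "(u, v) \<in> Restr (arcs_ends G) {x. depth x \<le> n}"
    using u Suc by auto
  ultimately show ?case by (rule rtrancl_into_rtrancl)
qed

text \<open>Cutting the loops out of a walk drops arcs and adds none, so the resulting path visits
  no new vertex.\<close>

lemma apath_of_rtrancl_Restr:
  assumes "(a, b) \<in> (Restr (arcs_ends G) B)\<^sup>*" "b \<in> verts G" "b \<in> B"
  shows "\<exists>p. apath a p b \<and> set (awalk_verts a p) \<subseteq> B"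
proof -
  from assms have "\<exists>p. awalk a p b \<and> set (awalk_verts a p) \<subseteq> B"
  proof (induction rule: converse_rtrancl_induct)
    case base
    then have "awalk b [] b \<and> set (awalk_verts b []) \<subseteq> B"
      by (simp add: awalk_Nil_iff)
    then show ?case by blast
  next
    case (step a c)
    then obtain p where p: "awalk c p b" "set (awalk_verts c p) \<subseteq> B" by blast
    obtain e where e: "e \<in> arcs G" "tail G e = a" "head G e = c"
      using step(1) by auto
    have "awalk a (e # p) b \<and> set (awalk_verts a (e # p)) \<subseteq> B"
      using p e step(1) by (auto simp: awalk_Cons_iff)
    then show ?case by blast
  qed
  then obtain p where p: "awalk a p b" "set (awalk_verts a p) \<subseteq> B" by blast
  let ?q = "awalk_to_apath p"
  have q: "apath a ?q b" by (rule apath_awalk_to_apath[OF p(1)])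
  have "set (awalk_verts a ?q) \<subseteq> set (awalk_verts a p)"
    using awalk_to_apath_subset[OF p(1)]
    unfolding set_awalk_verts[OF p(1)] set_awalk_verts[OF awalkI_apath[OF q]] by auto
  with p q show ?thesis by blast
qed

text \<open>Connect both vertices through the root. The depth bound keeps deeper vertices off the
  path, so that these can extend it to a longer path or a cycle.\<close>

lemma apath_in_ball:
  assumes "a \<in> verts G" "b \<in> verts G" "depth a \<le> n" "depth b \<le> n"
  shows "\<exists>p. apath a p b \<and> (\<forall>x\<in>set (awalk_verts a p). depth x \<le> n)"
proof -
  let ?R = "Restr (arcs_ends G) {x. depth x \<le> n}"
  have "sym ?R"
    by (auto intro!: symI dest: graph_symmetric)
  then have "(a, r) \<in> ?R\<^sup>*"
    using root_connected_in_ball[OF assms(1,3)] by (meson symE sym_rtrancl)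
  then have "(a, b) \<in> ?R\<^sup>*"
    using root_connected_in_ball[OF assms(2,4)] by (rule rtrancl_trans)
  with apath_of_rtrancl_Restr[of a b "{x. depth x \<le> n}"] assms show ?thesis by auto
qed

end

section \<open>Parents in a rooted tree\<close>

locale rooted_tree = rooted_graph G r for G :: "('a, 'b) pre_digraph" (structure) and r +
  assumes acyclic: "cycle p \<Longrightarrow> length p < 3"
begin

text \<open>The arc would close a cycle of length at least 3; the bound on \<open>length p\<close>
  rules out an edge walked back and forth.\<close>

lemma no_arc_between_apath_ends:
  assumes "apath u p v" "2 \<le> length p"
  shows "(v, u) \<notin> arcs_ends G"
proof
  assume "(v, u) \<in> arcs_ends G"
  then obtain e where e: "e \<in> arcs G" "tail G e = v" "head G e = u" by auto
  then have "cycle (e # p)"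
    using assms unfolding cycle_def by (auto simp: awalk_Cons_iff apath_def)
  with acyclic[of "e # p"] assms(2) show False by simp
qed

lemma apath_snoc:
  assumes "apath a p b" "e \<in> arcs G" "tail G e = b" "head G e \<notin> set (awalk_verts a p)"
  shows "apath a (p @ [e]) (head G e)"
    and "set (awalk_verts a (p @ [e])) = insert (head G e) (set (awalk_verts a p))"
proof -
  have p: "awalk a p b" using assms(1) by (simp add: awalkI_apath)
  have b: "b \<in> set (awalk_verts a p)"
    using p by (metis awalkE' awalk_verts_non_Nil last_in_set)
  have e: "awalk b [e] (head G e)"
    using assms by (auto simp: awalk_simps)
  show s: "set (awalk_verts a (p @ [e])) = insert (head G e) (set (awalk_verts a p))"
    using set_awalk_verts_append[OF p e] b assms(3) by auto
  show "apath a (p @ [e]) (head G e)"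
    using assms p b by (auto simp: apath_append_iff apath_simps)
qed

text \<open>If both ends lay on one level, their parents, joined by a path above that level, would
  complete the edge to a cycle. Equal parents give a triangle.\<close>

lemma depth_arc_neq:
  assumes "(u, v) \<in> arcs_ends G"
  shows "depth u \<noteq> depth v"
proof
  assume eq: "depth u = depth v"
  note uv = adj_in_verts[OF assms]
  have ne: "u \<noteq> v" using assms adj_not_same by blast
  with eq uv obtain n where n: "depth u = Suc n" "depth v = Suc n"
    by (metis depth_eq_0_iff not0_implies_Suc)
  obtain a where a: "(a, u) \<in> arcs_ends G" "depth a = n" using ex_parent uv n by blast
  obtain b where b: "(b, v) \<in> arcs_ends G" "depth b = n" using ex_parent uv n by blast
  obtain p where p: "apath a p b" "\<forall>x\<in>set (awalk_verts a p). depth x \<le> n"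
    using apath_in_ball[of a b n] a b adj_in_verts by auto
  obtain f where f: "f \<in> arcs G" "tail G f = b" "head G f = v" using b(1) by auto
  obtain e where e: "e \<in> arcs G" "tail G e = u" "head G e = a"
    using a(1) graph_symmetric by (metis reachableE)
  have vp: "v \<notin> set (awalk_verts a p)" and up: "u \<notin> set (awalk_verts a p)"
    using p(2) n by auto
  have "apath u (e # p @ [f]) v"
    using apath_snoc[OF p(1) f(1,2)] f(3) vp up e ne by (auto simp: apath_Cons_iff)
  then have "(v, u) \<notin> arcs_ends G"
    by (rule no_arc_between_apath_ends) simp
  with assms graph_symmetric show False by blast
qed

lemma parent_unique:
  assumes "(a, v) \<in> arcs_ends G" "depth v = Suc (depth a)"
    and "(b, v) \<in> arcs_ends G" "depth v = Suc (depth b)"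
  shows "a = b"
proof (rule ccontr)
  assume ne: "a \<noteq> b"
  obtain p where p: "apath a p b" "\<forall>x\<in>set (awalk_verts a p). depth x \<le> depth a"
    using apath_in_ball[of a b "depth a"] assms adj_in_verts(1) by auto
  obtain f where f: "f \<in> arcs G" "tail G f = b" "head G f = v" using assms(3) by auto
  have vp: "v \<notin> set (awalk_verts a p)"
    using p(2) assms(2) by auto
  have "p \<noteq> []" using p(1) ne by (auto simp: apath_Nil_iff)
  then have "2 \<le> length (p @ [f])" by (cases p) auto
  moreover have "apath a (p @ [f]) v"
    using apath_snoc(1)[OF p(1) f(1,2)] f(3) vp by auto
  ultimately have "(v, a) \<notin> arcs_ends G"
    using no_arc_between_apath_ends by blast
  with assms(1) graph_symmetric show False by blast
qed

lemma arc_depth_cases: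
  assumes "(u, v) \<in> arcs_ends G"
  obtains "depth v = Suc (depth u)" | "depth u = Suc (depth v)"
  using depth_arc_neq[OF assms] depth_arc_le[OF assms] depth_arc_le[OF graph_symmetric[OF assms]]
  by linarith

text \<open>Unspecified at the root; \<open>ancestor\<close> takes at most \<open>depth v\<close>
  steps up from \<open>v\<close> and so never goes beyond the root.\<close>

definition parent :: "'a \<Rightarrow> 'a" where
  "parent v = (THE u. (u, v) \<in> arcs_ends G \<and> depth v = Suc (depth u))"

lemma parent_eq: "(u, v) \<in> arcs_ends G \<Longrightarrow> depth v = Suc (depth u) \<Longrightarrow> parent v = u"
  unfolding parent_def using parent_unique by (intro the_equality) auto

text \<open>For \<open>i \<le> depth v\<close> this is the ancestor of \<open>v\<close> on level \<open>i\<close>; otherwise it is \<open>v\<close> itself.\<close>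

definition ancestor :: "nat \<Rightarrow> 'a \<Rightarrow> 'a" where
  "ancestor i v = (parent ^^ (depth v - i)) v"

lemma ancestor_depth [simp]: "ancestor (depth v) v = v"
  by (simp add: ancestor_def)

lemma ancestor_child:
  assumes "(u, v) \<in> arcs_ends G" "depth v = Suc (depth u)" "i \<le> depth u"
  shows "ancestor i v = ancestor i u"
proof -
  have "depth v - i = Suc (depth u - i)" using assms by simp
  then show ?thesis
    unfolding ancestor_def by (simp add: funpow_Suc_right parent_eq[OF assms(1,2)] del: funpow.simps)
qed

lemma ancestor_arc:
  assumes "(u, v) \<in> arcs_ends G" "i \<le> depth u" "i \<le> depth v"
  shows "ancestor i u = ancestor i v"
  using assms(1)
proof (cases rule: arc_depth_cases)
  case 1
  then show ?thesis using ancestor_child assms by metis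
next
  case 2
  then show ?thesis using ancestor_child[of v u] graph_symmetric assms by blast
qed

text \<open>A walk of length \<open>n\<close> from \<open>u\<close> to \<open>v\<close> stays on levels
  at least \<open>(depth u + depth v - n) / 2\<close>.\<close>

lemma ancestor_short_walk:
  assumes "(u, v) \<in> arcs_ends G ^^ n" "2 * i + n \<le> depth u + depth v"
  shows "ancestor i u = ancestor i v"
  using assms
proof (induction n arbitrary: u)
  case 0
  then show ?case by simp
next
  case (Suc n)
  from Suc.prems(1) obtain w where w: "(u, w) \<in> arcs_ends G" "(w, v) \<in> arcs_ends G ^^ n"
    by (meson relpow_Suc_D2)
  \<comment> \<open>These bounds put \<open>u\<close> and \<open>w\<close> on levels at least
    \<open>i\<close>, as \<open>ancestor_arc\<close> requires, and carry the numerical hypothesis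
    over to the walk from \<open>w\<close>.\<close>
  have du: "depth u \<le> Suc (depth w)" and dv: "depth v \<le> depth w + n" "depth v \<le> depth u + Suc n"
    using depth_arc_le[OF graph_symmetric[OF w(1)]] depth_relpow_le[OF w(2)]
      depth_relpow_le[OF Suc.prems(1)] by auto
  have "ancestor i u = ancestor i w"
    using ancestor_arc[OF w(1)] Suc.prems(2) du dv by auto
  also have "\<dots> = ancestor i v"
    using Suc.IH[OF w(2)] Suc.prems(2) du by auto
  finally show ?case .
qed

lemma relpow_ancestor:
  assumes "v \<in> verts G" "i \<le> depth v"
  shows "(ancestor i v, v) \<in> arcs_ends G ^^ (depth v - i)" "ancestor i v \<in> level i"
proof -
  have "(ancestor i v, v) \<in> arcs_ends G ^^ (depth v - i) \<and> ancestor i v \<in> level i"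
    using assms
  proof (induction "depth v - i" arbitrary: v)
    case 0
    then have "depth v = i" by simp
    with 0 show ?case by (auto simp: level_def)
  next
    case (Suc n)
    then have "depth v = Suc (depth v - 1)" by simp
    then obtain u where u: "(u, v) \<in> arcs_ends G" "depth u = depth v - 1"
      using ex_parent Suc.prems(1) by blast
    then have uv: "depth v = Suc (depth u)" "i \<le> depth u" "depth u - i = n"
        "depth v - i = Suc n" "u \<in> verts G"
      using Suc.hyps(2) adj_in_verts(1)[OF u(1)] by auto
    then have "(ancestor i u, u) \<in> arcs_ends G ^^ n \<and> ancestor i u \<in> level i"
      using Suc.hyps(1)[of u] by auto
    moreover have "ancestor i v = ancestor i u"
      using ancestor_child[OF u(1) uv(1,2)] .
    ultimately show ?case using u(1) uv(4) by (auto intro: relpow_Suc_I)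
  qed
  then show "(ancestor i v, v) \<in> arcs_ends G ^^ (depth v - i)" "ancestor i v \<in> level i"
    by auto
qed

lemma level_dist:
  assumes "w \<in> level j" "w' \<in> level j"
  shows "(w, w') \<in> arcs_ends G ^^ (j + j)"
proof -
  have "(w, r) \<in> arcs_ends G ^^ j" "(r, w') \<in> arcs_ends G ^^ j"
    using assms root_relpow_depth[of w] root_relpow_depth[of w'] relpow_sym
    by (auto simp: level_def)
  then show ?thesis by (rule relpow_trans)
qed

end

section \<open>Perfect trees\<close>

locale perfect_rooted_tree = rooted_tree G r for G :: "('a, 'b) pre_digraph" (structure) and r +
  fixes m d :: nat
  assumes card_children: "v \<in> verts G \<Longrightarrow> children G r v \<noteq> {} \<Longrightarrow> card (children G r v) = m"
    and depth_leaf: "v \<in> verts G \<Longrightarrow> children G r v = {} \<Longrightarrow> depth v = d"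
begin

lemma depth_le_height:
  assumes "v \<in> verts G"
  shows "depth v \<le> d"
proof -
  let ?M = "Max (depth ` verts G)"
  have fin: "finite (depth ` verts G)" by simp
  have "?M \<in> depth ` verts G" using assms fin by (intro Max_in) auto
  then obtain x where x: "x \<in> verts G" "depth x = ?M" by auto
  \<comment> \<open>A deepest vertex has no children, so it is a leaf and the maximal depth is
    \<open>d\<close>.\<close>
  have "children G r x = {}"
  proof (rule ccontr)
    assume "children G r x \<noteq> {}"
    then obtain y where "(x, y) \<in> arcs_ends G" "depth y = Suc (depth x)"
      using children_conv[OF x(1)] by auto
    then have "Suc ?M \<in> depth ` verts G"
      using x(2) adj_in_verts(2) by (metis imageI)
    then show False using Max_ge[OF fin] by fastforce
  qed
  then have "?M = d" using depth_leaf x by auto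
  then show ?thesis using Max_ge[OF fin] assms by auto
qed

lemma card_children_inner:
  assumes "v \<in> verts G" "depth v < d"
  shows "card (children G r v) = m"
  using card_children depth_leaf assms by fastforce

lemma level_Suc: "level (Suc n) = (\<Union>v\<in>level n. children G r v)"
proof (intro equalityI subsetI)
  fix w assume "w \<in> level (Suc n)"
  then have w: "w \<in> verts G" "depth w = Suc n" by (auto simp: level_def)
  then obtain u where u: "(u, w) \<in> arcs_ends G" "depth u = n" using ex_parent by blast
  then have "u \<in> level n" "w \<in> children G r u"
    using adj_in_verts(1)[OF u(1)] w by (auto simp: level_def children_conv)
  then show "w \<in> (\<Union>v\<in>level n. children G r v)" by blast
next
  fix w assume "w \<in> (\<Union>v\<in>level n. children G r v)"
  then show "w \<in> level (Suc n)"
    using adj_in_verts(2) by (auto simp: level_def children_conv)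
qed

lemma card_level: "n \<le> d \<Longrightarrow> card (level n) = m ^ n"
proof (induction n)
  case 0
  have "level 0 = {r}" using depth_eq_0_iff root_in_verts by (auto simp: level_def)
  then show ?case by simp
next
  case (Suc n)
  have "card (level (Suc n)) = (\<Sum>v\<in>level n. card (children G r v))"
    unfolding level_Suc
  proof (rule card_UN_disjoint)
    show "\<forall>v\<in>level n. finite (children G r v)"
      by (simp add: children_def)
    show "\<forall>u\<in>level n. \<forall>v\<in>level n. u \<noteq> v \<longrightarrow> children G r u \<inter> children G r v = {}"
      using parent_unique by (fastforce simp: level_def children_conv)
  qed (rule finite_level)
  also have "\<dots> = (\<Sum>v\<in>level n. m)"
    using Suc.prems by (intro sum.cong) (auto simp: level_def card_children_inner)
  finally show ?case using Suc by simp
qed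

lemma ex_descendant:
  assumes "0 < m" "w \<in> level i" "i \<le> n" "n \<le> d"
  shows "\<exists>x\<in>level n. ancestor i x = w"
  using assms(3,4)
proof (induction n rule: dec_induct)
  case base
  then show ?case using assms(2) ancestor_depth by (auto simp: level_def)
next
  case (step n)
  then obtain x where x: "x \<in> verts G" "depth x = n" "ancestor i x = w"
    by (auto simp: level_def)
  then have "children G r x \<noteq> {}"
    using card_children_inner[of x] step assms(1) by auto
  then obtain y where y: "(x, y) \<in> arcs_ends G" "depth y = Suc (depth x)"
    using children_conv[OF x(1)] by auto
  then have "ancestor i y = w" using ancestor_child[OF y] x step by auto
  moreover have "y \<in> level (Suc n)"
    using adj_in_verts(2)[OF y(1)] y(2) x(2) by (simp add: level_def)
  ultimately show ?case by blast
qed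

text \<open>A vertex on or below level \<open>j\<close> has its ancestor there, at most
  \<open>d - j\<close> steps up; a vertex above it has a descendant there, at most \<open>j\<close>
  steps down.\<close>

lemma level_near:
  assumes "0 < m" "v \<in> verts G" "j \<le> d"
  shows "\<exists>w\<in>level j. \<exists>i\<le>max j (d - j). (w, v) \<in> arcs_ends G ^^ i"
proof (cases "j \<le> depth v")
  case True
  then show ?thesis
    using relpow_ancestor[OF assms(2) True] depth_le_height[OF assms(2)]
    by (intro bexI[of _ "ancestor j v"] exI[of _ "depth v - j"]) auto
next
  case False
  have "v \<in> level (depth v)" using assms(2) by (simp add: level_def)
  then obtain x where x: "x \<in> level j" "ancestor (depth v) x = v"
    using ex_descendant[of v "depth v" j] False assms by auto
  then have "(v, x) \<in> arcs_ends G ^^ (j - depth v)"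
    using relpow_ancestor(1)[of x "depth v"] False by (auto simp: level_def)
  then show ?thesis
    using x(1) by (intro bexI[of _ x] exI[of _ "j - depth v"]) (auto intro: relpow_sym)
qed

section \<open>Eternal domination\<close>

text \<open>A walk of length at most \<open>k\<close> from \<open>x\<close> climbs at most
  \<open>k\<close> levels. The second part is kept for all \<open>i\<close> because two values
  matter: \<open>i = d - k\<close>, which locates \<open>y\<close> in the subtree of
  \<open>x\<close>, and \<open>i = d - k + 1\<close>, which separates the children of the subtree's
  root when \<open>y\<close> is a leaf.\<close>

lemma dominating_depth:
  assumes "distance_dominating G k D" "x \<in> level d"
  shows "\<exists>y\<in>#D. depth y \<ge> d - k \<and> (\<forall>i. 2 * i + k \<le> d + depth y \<longrightarrow> ancestor i y = ancestor i x)"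
proof -
  have x: "x \<in> verts G" "depth x = d" using assms(2) by (auto simp: level_def)
  have D: "set_mset D \<subseteq> verts G" using assms(1) by (simp add: distance_dominating_def)
  have "\<exists>y\<in>#D. \<exists>n\<le>k. (x, y) \<in> arcs_ends G ^^ n"
  proof (cases "x \<in># D")
    case True
    then show ?thesis by (intro bexI[of _ x] exI[of _ 0]) auto
  next
    case False
    then obtain y where "y \<in># D" "gdist G x y \<le> ereal (real k)"
      using assms(1) x unfolding distance_dominating_def by blast
    then show ?thesis using gdist_le_iff[OF x(1)] D by blast
  qed
  then obtain y n where y: "y \<in># D" "n \<le> k" "(x, y) \<in> arcs_ends G ^^ n" by blast
  have "depth y \<ge> d - k"
    using depth_relpow_le[OF relpow_sym[OF y(3)]] x y(2) by simp
  moreover have "ancestor i y = ancestor i x" if "2 * i + k \<le> d + depth y" for i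
    using ancestor_short_walk[OF y(3), of i] that x y(2) by simp
  ultimately show ?thesis using y(1) by blast
qed

text \<open>Each of the subtrees rooted on level \<open>d - k\<close> needs a guard of its own, and a single guard
  standing on a leaf of such a subtree reaches no leaf below another child of the subtree's root.\<close>

lemma eternal_lower_bound:
  assumes "m \<ge> 2" "k \<ge> 2" "k \<le> d" "eternal_dominating_family G k q \<E>"
  shows "1 + m ^ (d - k) \<le> q"
proof -
  define j where "j = d - k"
  have j: "j + k = d" using assms(3) by (simp add: j_def)
  have "card (level j) \<noteq> 0" using card_level[of j] j assms(1) by simp
  then obtain w0 where w0: "w0 \<in> level j" by fastforce
  then have w0': "w0 \<in> verts G" "depth w0 = j" by (auto simp: level_def)
  have "card (children G r w0) = m"
    using card_children_inner w0' j assms(2) by simp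
  then obtain c0 c1 where c: "c0 \<in> children G r w0" "c1 \<in> children G r w0" "c0 \<noteq> c1"
    using assms(1) by (metis card_2_iff' card_le_Suc0_iff_eq card.infinite not_less_eq_eq
        numeral_2_eq_2 not_numeral_le_zero)
  have leaf: "\<exists>x\<in>level d. ancestor (Suc j) x = c \<and> ancestor j x = w0"
    if "c \<in> children G r w0" for c
  proof -
    have c: "(w0, c) \<in> arcs_ends G" "depth c = Suc (depth w0)" "c \<in> level (Suc j)"
      using that children_conv[OF w0'(1)] w0' adj_in_verts(2) by (auto simp: level_def)
    obtain x where x: "x \<in> level d" "ancestor (Suc j) x = c"
      using ex_descendant[of c "Suc j" d] c(3) assms j by auto
    then have xv: "x \<in> verts G" "depth x = d" by (auto simp: level_def)
    have "(c, x) \<in> arcs_ends G ^^ (d - Suc j)"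
      using relpow_ancestor(1)[of x "Suc j"] x xv j assms(2) by simp
    then have "ancestor j c = ancestor j x"
      by (rule ancestor_short_walk) (use c xv w0' j assms(2) in auto)
    moreover have "ancestor j c = w0"
      using ancestor_child[OF c(1,2), of j] w0' ancestor_depth[of w0] by simp
    ultimately show ?thesis using x by auto
  qed
  obtain x0 where x0: "x0 \<in> level d" "ancestor (Suc j) x0 = c0" "ancestor j x0 = w0"
    using leaf c by blast
  obtain x1 where x1: "x1 \<in> level d" "ancestor (Suc j) x1 = c1" "ancestor j x1 = w0"
    using leaf c by blast
  have x0v: "x0 \<in> verts G" "depth x0 = d" using x0 by (auto simp: level_def)
  \<comment> \<open>\<open>D\<close> answers an attack on \<open>x0\<close>, starting from any
    member of the nonempty family.\<close>
  obtain D where D: "x0 \<in># D" "distance_dominating G k D" "size D = q"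
    using assms(4) x0v(1) unfolding eternal_dominating_family_def dominating_msets_def by blast
  \<comment> \<open>Even without \<open>x0\<close>, every subtree rooted on level \<open>j\<close>
    contains a guard, so the support of \<open>D\<close> has more than \<open>m ^ j\<close>
    vertices.\<close>
  have "level j \<subseteq> ancestor j ` (set_mset D - {x0})"
  proof
    fix w assume w: "w \<in> level j"
    show "w \<in> ancestor j ` (set_mset D - {x0})"
    proof (cases "w = w0")
      case True
      obtain y where y: "y \<in># D" "depth y \<ge> d - k"
          "\<And>i. 2 * i + k \<le> d + depth y \<Longrightarrow> ancestor i y = ancestor i x1"
        using dominating_depth[OF D(2) x1(1)] by blast
      have "ancestor j y = w0" using y(2,3) j x1(3) by auto
      moreover have "y \<noteq> x0"
      proof
        assume "y = x0"
        \<comment> \<open>For a leaf \<open>y\<close> the index \<open>Suc j\<close> is admissible: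
          \<open>2 * Suc j + k <= 2 * d\<close> amounts to \<open>2 <= k\<close>.\<close>
        then have "c0 = c1" using y(3)[of "Suc j"] x0v(2) j assms(2) x0(2) x1(2) by auto
        with c(3) show False by simp
      qed
      ultimately show ?thesis using True y(1) by blast
    next
      case False
      obtain x where x: "x \<in> level d" "ancestor j x = w"
        using ex_descendant[of w j d] w assms(1) j by auto
      obtain y where y: "y \<in># D" "depth y \<ge> d - k"
          "\<And>i. 2 * i + k \<le> d + depth y \<Longrightarrow> ancestor i y = ancestor i x"
        using dominating_depth[OF D(2) x(1)] by blast
      have "ancestor j y = w" using y(2,3) j x(2) by auto
      with False x0(3) y(1) show ?thesis by blast
    qed
  qed
  then have "card (level j) \<le> card (set_mset D - {x0})"
    by (meson finite_Diff finite_set_mset surj_card_le)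
  then have "m ^ j < card (set_mset D)"
    using card_level[of j] j D(1)
    by (metis card_Diff1_less finite_set_mset le_add1 le_less_trans)
  also have "\<dots> \<le> size D"
    using size_mset_mono[OF mset_set_set_mset_msubset[of D]] by simp
  finally show ?thesis using D(3) j_def by simp
qed

text \<open>When a vertex \<open>u\<close> is attacked, a guard on level \<open>j\<close> near \<open>u\<close> answers, the spare guard
  returns to level \<open>j\<close>, and the gap is closed by one move within level \<open>j\<close>, of length at
  most \<open>2 * j \<le> k\<close>.\<close>

lemma eternal_family_exists:
  assumes "0 < m" "j + k = d" "2 * j \<le> k"
  shows "eternal_dominating_family G k (1 + m ^ j)
    ((\<lambda>v. add_mset v (mset_set (level j))) ` verts G)"
proof -
  let ?W = "level j"
  have mk: "max j (d - j) = k" using assms by auto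
  have near: "\<exists>w\<in>?W. w \<in> nbhd G k v \<and> v \<in> nbhd G k w" if v: "v \<in> verts G" for v
  proof -
    obtain w i where w: "w \<in> ?W" "i \<le> k" "(w, v) \<in> arcs_ends G ^^ i"
      using level_near[OF assms(1) v, of j] assms(2) unfolding mk by auto
    have "w \<in> verts G" using w(1) by (simp add: level_def)
    with w v relpow_sym[OF w(3)] show ?thesis
      unfolding nbhd_def by (auto simp: gdist_le_iff intro!: bexI[of _ w])
  qed
  have nbhd_refl: "v \<in> nbhd G k v" if "v \<in> verts G" for v
    using that unfolding nbhd_def by (auto simp: gdist_le_iff intro!: exI[of _ 0])
  have dom: "add_mset v (mset_set ?W) \<in> dominating_msets G k (1 + m ^ j)"
    if v: "v \<in> verts G" for v
  proof -
    have "distance_dominating G k (add_mset v (mset_set ?W))"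
      unfolding distance_dominating_def
    proof (intro conjI ballI)
      show "set_mset (add_mset v (mset_set ?W)) \<subseteq> verts G"
        using v finite_level[of j] by (auto simp: level_def)
      fix x assume "x \<in> verts G - set_mset (add_mset v (mset_set ?W))"
      then obtain w where "w \<in> ?W" "w \<in> nbhd G k x" using near by blast
      then show "\<exists>u\<in>#add_mset v (mset_set ?W). gdist G x u \<le> ereal (real k)"
        using finite_level[of j] by (auto simp: nbhd_def)
    qed
    then show ?thesis
      using card_level[of j] assms(2) by (simp add: dominating_msets_def)
  qed
  have move: "transforms_to G k (add_mset v (mset_set ?W)) (add_mset u (mset_set ?W))"
    if v: "v \<in> verts G" and u: "u \<in> verts G" for u v
  proof -
    let ?R = "\<lambda>v u. u \<in> nbhd G k v"
    have rest: "rel_mset ?R (mset_set A) (mset_set A)" if "A \<subseteq> ?W" for A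
    proof (rule multiset.rel_refl_strong)
      fix x assume "x \<in># mset_set A"
      then show "x \<in> nbhd G k x"
        using that nbhd_refl finite_subset[OF that finite_level] by (auto simp: level_def)
    qed
    obtain w where w: "w \<in> ?W" "?R v w" using near v by blast
    obtain w' where w': "w' \<in> ?W" "?R w' u" using near u by blast
    show ?thesis
    proof (cases "w = w'")
      \<comment> \<open>Two moves suffice: \<open>v\<close> to \<open>w\<close> and \<open>w\<close>
        to \<open>u\<close>. Both multisets are listed so that each guard faces its target.\<close>
      case True
      have W: "mset_set ?W = add_mset w (mset_set (?W - {w}))"
        using w(1) finite_level by (simp add: mset_set.remove)
      have "rel_mset ?R (add_mset v (add_mset w (mset_set (?W - {w}))))
          (add_mset w (add_mset u (mset_set (?W - {w}))))"
        using w w' True by (intro rel_mset_Plus rest) auto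
      then show ?thesis
        unfolding transforms_to_def W by (simp add: add_mset_commute)
    next
      \<comment> \<open>Three moves: \<open>v\<close> to \<open>w\<close>, \<open>w\<close> to
        \<open>w'\<close> and \<open>w'\<close> to \<open>u\<close>, where the middle one passes
        through the root.\<close>
      case False
      have W: "mset_set ?W = add_mset w (add_mset w' (mset_set (?W - {w} - {w'})))"
        using mset_set.remove[OF finite_level w(1)] mset_set.remove[of "?W - {w}" w'] w'(1) False
          finite_level by simp
      have "w \<in> verts G" "w' \<in> verts G" using w w' by (auto simp: level_def)
      then have "?R w w'"
        using level_dist[OF w(1) w'(1)] assms(3) unfolding nbhd_def
        by (auto simp: gdist_le_iff intro!: exI[of _ "j + j"])
      then have "rel_mset ?R (add_mset v (add_mset w (add_mset w' (mset_set (?W - {w} - {w'})))))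
          (add_mset w (add_mset w' (add_mset u (mset_set (?W - {w} - {w'})))))"
        using w w' by (intro rel_mset_Plus rest) auto
      then show ?thesis
        unfolding transforms_to_def W by (simp add: add_mset_commute)
    qed
  qed
  show ?thesis
    unfolding eternal_dominating_family_def using dom move root_in_verts by fastforce
qed

lemma eternal_domination_number_eq:
  assumes "m \<ge> 2" "k \<ge> 2" "k \<le> d" "2 * d \<le> 3 * k"
  shows "eternal_domination_number G k = 1 + m ^ (d - k)"
  unfolding eternal_domination_number_def
proof (rule Least_equality)
  show "\<exists>\<E>. eternal_dominating_family G k (1 + m ^ (d - k)) \<E>"
    by (rule exI, rule eternal_family_exists) (use assms in auto)
qed (use eternal_lower_bound assms in blast)

end

section \<open>From the definition of a perfect tree to the locale\<close>

lemma perfect_rooted_treeI: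
  assumes "perfect_tree m d T r"
  shows "perfect_rooted_tree T r m d"
proof -
  have T: "graph T" "connected T" "\<not> (\<exists>p. pre_digraph.cycle T p \<and> length p \<ge> 3)" "r \<in> verts T"
    using assms by (auto simp: perfect_tree_def undirected_tree_def)
  interpret graph T by (rule T(1))
  interpret rooted_graph T r
  proof
    fix v assume "v \<in> verts T"
    \<comment> \<open>\<open>connected\<close> speaks of the symmetric closure, which has the same
      reachability as the symmetric digraph \<open>T\<close>.\<close>
    then have "r \<rightarrow>\<^sup>*\<^bsub>mk_symmetric T\<^esub> v"
      using T(2,4) by (auto simp: connected_def strongly_connected_def)
    then show "r \<rightarrow>\<^sup>*\<^bsub>T\<^esub> v"
      using reachable_mk_symmetric_eq[OF sym_arcs] by simp
  qed (rule T(4))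
  show ?thesis
  proof
    show "length p < 3" if "cycle p" for p
      using T(3) that by fastforce
    show "card (children T r v) = m" if "v \<in> verts T" "children T r v \<noteq> {}" for v
      using assms that by (auto simp: perfect_tree_def)
    show "depth v = d" if "v \<in> verts T" "children T r v = {}" for v
      using assms that gdist_root[OF that(1)] by (auto simp: perfect_tree_def)
  qed
qed

theorem theorem5:
  fixes T :: "('a, 'b) pre_digraph" and r :: 'a and m k d :: nat
  assumes "m \<ge> 2" and "k \<ge> 2"
    and "perfect_tree m d T r"
    and "k \<le> d" and "real d \<le> 3 * real k / 2"
  shows "eternal_domination_number T k = 1 + m ^ (d - k)"
proof -
  have "2 * d \<le> 3 * k" using assms(5) by linarith
  with perfect_rooted_tree.eternal_domination_number_eq[OF perfect_rooted_treeI[OF assms(3)]] assms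
  show ?thesis by blast
qed

end
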